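(* For contextuality scenarios with non-trivial equivalences of preparations, pure states cannot in general produce all quantum contextual behaviours. That is, there exists a contextuality scenario $T=(X,Y,K,\mathcal{OE}_P,\mathcal{OE}_M)$ with $\mathcal{OE}_P\neq\emptyset$ for which $\mathcal{Q}^{\Psi}\subsetneq\mathcal{Q}$.
   Context: For a positive integer $N$, $[N]=\{0,\dots,N-1\}$. A contextuality scenario is a tuple $T=(X,Y,K,\mathcal{OE}_P,\mathcal{OE}_M)$ where $X,Y,K$ are positive integers (numbers of preparations, measurements, and outcomes per measurement), $\mathcal{OE}_P=\{\{\alpha^v_j\}_{j\in[V_v]}\}_{v\in[V]}$ is a finite (possibly empty) family in which each $\{\alpha^v_j\}_{j\in[V_v]}$ consists of $V_v\ge 2$ distinct probability distributions on $[X]$, and $\mathcal{OE}_M=\{\{\beta^w_j\}_{j\in[W_w]}\}_{w\in[W]}$ is a finite (possibly empty) family in which each $\{\beta^w_j\}_{j\in[W_w]}$ consists of $W_w\ge 2$ distinct probability distributions on $[K]\times[Y]$. Non-trivial preparation equivalences means $\mathcal{OE}_P\ne\emptyset$. A behaviour is a vector $\mathbf{p}=(p(k|x,y))_{x\in[X],y\in[Y],k\in[K]}\in\mathbb{R}^{XYK}$. $\mathcal{Q}$ is the set of behaviours for which there exist a finite-dimensional complex Hilbert space $\mathcal{H}$ (of arbitrary dimension), density operators $\rho_x$ ($x\in[X]$) on $\mathcal{H}$ and POVMs $\{M^y_k\}_{k\in[K]}$ ($y\in[Y]$) on $\mathcal{H}$ (i.e. $M^y_k\ge0$, $\sum_kM^y_k=\mathbb{I}$)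 such that $p(k|x,y)=\operatorname{tr}(\rho_xM^y_k)$ for all $x,y,k$, and: (i) for every $v\in[V]$ the operator $\sum_x\alpha^v_j(x)\rho_x$ is the same for all $j\in[V_v]$; (ii) for every $w\in[W]$ the operator $\sum_{k,y}\beta^w_j(k,y)M^y_k$ is the same for all $j\in[W_w]$. $\mathcal{Q}^{\Psi}\subseteq\mathcal{Q}$ is the set of behaviours admitting such a realisation in which in addition every state is pure, i.e. $\rho_x^2=\rho_x$ for all $x\in[X]$. *)

theory Defs
  imports
    "HOL-Probability.Probability_Mass_Function"
    "Jordan_Normal_Form.Matrix"
    "Jordan_Normal_Form.Conjugate"
begin

(* The families are lists, so that the indices v, w and j are list positions.  A probability
   distribution on a finite set I is a pmf whose support is contained in I. *)

record scenario =
  n_preps :: nat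
  n_meas :: nat
  n_outs :: nat
  prep_equivs :: "nat pmf list list"
  meas_equivs :: "(nat \<times> nat) pmf list list"

definition equiv_family :: "'i set \<Rightarrow> 'i pmf list \<Rightarrow> bool" where
  "equiv_family I ps \<longleftrightarrow> length ps \<ge> 2 \<and> distinct ps \<and> (\<forall>a\<in>set ps. set_pmf a \<subseteq> I)"

definition contextuality_scenario :: "scenario \<Rightarrow> bool" where
  "contextuality_scenario T \<longleftrightarrow>
     n_preps T > 0 \<and> n_meas T > 0 \<and> n_outs T > 0 \<and>
     (\<forall>ps\<in>set (prep_equivs T). equiv_family {..<n_preps T} ps) \<and>
     (\<forall>ps\<in>set (meas_equivs T). equiv_family ({..<n_outs T} \<times> {..<n_meas T}) ps)"

(* A behaviour is indexed by triples (k, x, y), with p (k, x, y) standing for p(k|x,y); being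
   extensional, it carries no data outside the index set. *)

definition behaviours :: "scenario \<Rightarrow> (nat \<times> nat \<times> nat \<Rightarrow> real) set" where
  "behaviours T = ({..<n_outs T} \<times> {..<n_preps T} \<times> {..<n_meas T}) \<rightarrow>\<^sub>E UNIV"

(* Operators on the d-dimensional complex Hilbert space are d x d complex matrices. *)

definition mat_trace :: "complex mat \<Rightarrow> complex" where
  "mat_trace A = (\<Sum>i<dim_row A. A $$ (i, i))"

(* The order on the complex numbers is that of Complex_Order: 0 \<le> z means that z is real and
   nonnegative.  Hence positivity in this sense entails that A is Hermitian. *)

definition positive_op :: "nat \<Rightarrow> complex mat \<Rightarrow> bool" where
  "positive_op d A \<longleftrightarrow>
     A \<in> carrier_mat d d \<and> (\<forall>v\<in>carrier_vec d. 0 \<le> (A *\<^sub>v v) \<bullet>c v)"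

definition density_op :: "nat \<Rightarrow> complex mat \<Rightarrow> bool" where
  "density_op d \<rho> \<longleftrightarrow> positive_op d \<rho> \<and> mat_trace \<rho> = 1"

definition pure_state :: "complex mat \<Rightarrow> bool" where
  "pure_state \<rho> \<longleftrightarrow> \<rho> * \<rho> = \<rho>"

(* Entrywise, since the type of matrices of all dimensions has no single zero, so that sum is
   not available on it. *)

definition op_sum :: "nat \<Rightarrow> ('i \<Rightarrow> complex mat) \<Rightarrow> 'i set \<Rightarrow> complex mat" where
  "op_sum d A I = mat d d (\<lambda>(r, c). \<Sum>i\<in>I. A i $$ (r, c))"

definition povm :: "nat \<Rightarrow> nat \<Rightarrow> (nat \<Rightarrow> complex mat) \<Rightarrow> bool" where
  "povm d K E \<longleftrightarrow> (\<forall>k<K. positive_op d (E k)) \<and> op_sum d E {..<K} = 1\<^sub>m d"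

definition mixture :: "nat \<Rightarrow> 'i set \<Rightarrow> 'i pmf \<Rightarrow> ('i \<Rightarrow> complex mat) \<Rightarrow> complex mat" where
  "mixture d I a A = op_sum d (\<lambda>i. complex_of_real (pmf a i) \<cdot>\<^sub>m A i) I"

definition respects_equivs ::
    "nat \<Rightarrow> 'i set \<Rightarrow> 'i pmf list list \<Rightarrow> ('i \<Rightarrow> complex mat) \<Rightarrow> bool" where
  "respects_equivs d I OE A \<longleftrightarrow>
     (\<forall>ps\<in>set OE. \<forall>a\<in>set ps. \<forall>b\<in>set ps. mixture d I a A = mixture d I b A)"

(* M y k is the effect of outcome k of measurement y. *)

definition quantum_realisation ::
    "scenario \<Rightarrow> nat \<Rightarrow> (nat \<Rightarrow> complex mat) \<Rightarrow> (nat \<Rightarrow> nat \<Rightarrow> complex mat) \<Rightarrow>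
     (nat \<times> nat \<times> nat \<Rightarrow> real) \<Rightarrow> bool" where
  "quantum_realisation T d \<rho> M p \<longleftrightarrow>
     (\<forall>x<n_preps T. density_op d (\<rho> x)) \<and>
     (\<forall>y<n_meas T. povm d (n_outs T) (M y)) \<and>
     (\<forall>k<n_outs T. \<forall>x<n_preps T. \<forall>y<n_meas T.
        complex_of_real (p (k, x, y)) = mat_trace (\<rho> x * M y k)) \<and>
     respects_equivs d {..<n_preps T} (prep_equivs T) \<rho> \<and>
     respects_equivs d ({..<n_outs T} \<times> {..<n_meas T}) (meas_equivs T) (\<lambda>(k, y). M y k)"

definition quantum_behaviours :: "scenario \<Rightarrow> (nat \<times> nat \<times> nat \<Rightarrow> real) set" where
  "quantum_behaviours T = {p \<in> behaviours T. \<exists>d \<rho> M. quantum_realisation T d \<rho> M p}"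

definition pure_quantum_behaviours :: "scenario \<Rightarrow> (nat \<times> nat \<times> nat \<Rightarrow> real) set" where
  "pure_quantum_behaviours T =
     {p \<in> behaviours T. \<exists>d \<rho> M. quantum_realisation T d \<rho> M p \<and>
                                (\<forall>x<n_preps T. pure_state (\<rho> x))}"

end

(* Three preparations, the third constrained to be the even mixture of the first two.  Pure states
   are extremal: by the parallelogram law (A - B)^2 = 2 A^2 + 2 B^2 - (A + B)^2, which vanishes if
   A, B and (A + B) / 2 are idempotent, so that A = B because A - B is Hermitian.  Hence pure
   realisations cannot distinguish the first two preparations, whereas a classical bit can. *)
theory Submission
  imports Defs
begin

text \<open>Polarisation: the quadratic form is real on \<open>e_i + c e_j\<close> for every scalar
  \<open>c\<close>, and two choices of \<open>c\<close> determine how the two off-diagonal entries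
  are related.\<close>

lemma positive_op_hermitian:
  assumes "positive_op d A" "i < d" "j < d"
  shows "A $$ (j, i) = cnj (A $$ (i, j))"
proof -
  have real: "Im ((A *\<^sub>v v) \<bullet>c v) = 0" if "v \<in> carrier_vec d" for v
    using assms(1) that by (auto simp: positive_op_def less_eq_complex_def)
  \<comment> \<open>Scaled basis vectors, so that the form evaluated at a pair of them reads off a
    single matrix entry.\<close>
  define u where "u k c = c \<cdot>\<^sub>v unit_vec d k" for k and c :: complex
  have u: "u k c \<in> carrier_vec d" for k c
    by (simp add: u_def)
  have A: "A \<in> carrier_mat d d"
    using assms(1) by (simp add: positive_op_def)
  have Au: "A *\<^sub>v u k c \<in> carrier_vec d" for k c
    using A u by simp
  have entry: "(A *\<^sub>v u k c) \<bullet>c u l b = c * cnj b * A $$ (l, k)" if "k < d" "l < d" for k l b c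
  proof -
    have "A *\<^sub>v u k c = c \<cdot>\<^sub>v col A k"
      using A that by (auto simp: u_def mult_mat_vec)
    moreover have "conjugate (u l b) = cnj b \<cdot>\<^sub>v unit_vec d l"
      using that by (intro eq_vecI) (auto simp: u_def unit_vec_def)
    ultimately show ?thesis
      using A that by simp
  qed
  have exp: "(A *\<^sub>v (u i 1 + u j c)) \<bullet>c (u i 1 + u j c) =
      A $$ (i, i) + cnj c * A $$ (j, i) + (c * A $$ (i, j) + c * cnj c * A $$ (j, j))" for c
  proof -
    have "(A *\<^sub>v (u i 1 + u j c)) \<bullet>c (u i 1 + u j c) =
        (A *\<^sub>v u i 1) \<bullet>c u i 1 + (A *\<^sub>v u i 1) \<bullet>c u j c +
        ((A *\<^sub>v u j c) \<bullet>c u i 1 + (A *\<^sub>v u j c) \<bullet>c u j c)"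
      using A u Au by (simp add: mult_add_distrib_mat_vec[of A d d] conjugate_add_vec[of _ d]
          add_scalar_prod_distrib[of _ d] scalar_prod_add_distrib[of _ d])
    then show ?thesis
      using assms by (simp add: entry)
  qed
  have diag: "Im (A $$ (k, k)) = 0" if "k < d" for k
    using real[OF u, of k 1] entry[of k k 1 1] that by simp
  have "u i 1 + u j c \<in> carrier_vec d" for c
    using u by simp
  \<comment> \<open>With the diagonal real, \<open>c = 1\<close> makes the imaginary parts of the
    two entries opposite, and \<open>c\<close> the imaginary unit makes their real parts
    equal.\<close>
  from real[OF this, of 1] real[OF this, of \<i>] diag assms show ?thesis
    by (simp add: exp complex_eq_iff)
qed

lemma pure_state_entry:
  assumes "A \<in> carrier_mat d d" "pure_state A" "i < d"
  shows "(\<Sum>j<d. A $$ (i, j) * A $$ (j, i)) = A $$ (i, i)"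
proof -
  have "(A * A) $$ (i, i) = (\<Sum>j<d. A $$ (i, j) * A $$ (j, i))"
    using assms(1,3) by (simp add: scalar_prod_def atLeast0LessThan)
  then show ?thesis
    using assms(2) by (simp add: pure_state_def)
qed

text \<open>The parallelogram argument is run on diagonal entries only: entry \<open>(i, i)\<close>
  of \<open>(A - B)^2\<close> is the squared norm of row \<open>i\<close> of \<open>A - B\<close>,
  so its vanishing kills the whole row.\<close>

lemma pure_midpoint_unique:
  assumes "positive_op d A" "positive_op d B" "P \<in> carrier_mat d d"
    and "pure_state A" "pure_state B" "pure_state P"
    and mid: "\<And>r c. r < d \<Longrightarrow> c < d \<Longrightarrow> P $$ (r, c) = (A $$ (r, c) + B $$ (r, c)) / 2"
  shows "A = B"
proof -
  have A: "A \<in> carrier_mat d d" and B: "B \<in> carrier_mat d d"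
    using assms by (auto simp: positive_op_def)
  have eq: "A $$ (i, j) = B $$ (i, j)" if i: "i < d" and j: "j < d" for i j
  proof -
    let ?D = "\<lambda>i j. A $$ (i, j) - B $$ (i, j)"
    \<comment> \<open>Both matrices are Hermitian, so \<open>?D j i\<close> is the conjugate of
      \<open>?D i j\<close>.\<close>
    have "complex_of_real (\<Sum>j<d. (cmod (?D i j))\<^sup>2) = (\<Sum>j<d. ?D i j * ?D j i)"
      unfolding of_real_sum
      by (intro sum.cong refl)
         (simp only: complex_norm_square complex_cnj_diff lessThan_iff
            positive_op_hermitian[OF assms(1) i] positive_op_hermitian[OF assms(2) i])
    \<comment> \<open>The parallelogram law term by term; the factor 4 arises from
      \<open>A + B = 2 P\<close>.\<close>
    also have "\<dots> = (\<Sum>j<d. 2 * (A $$ (i, j) * A $$ (j, i)) + 2 * (B $$ (i, j) * B $$ (j, i))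
        - 4 * (P $$ (i, j) * P $$ (j, i)))"
      using i by (intro sum.cong refl) (simp add: mid field_simps)
    also have "\<dots> = 2 * A $$ (i, i) + 2 * B $$ (i, i) - 4 * P $$ (i, i)"
      using assms A B i by (simp add: sum.distrib sum_subtractf sum_distrib_left[symmetric]
          pure_state_entry)
    also have "\<dots> = 0"
      using i by (simp add: mid)
    finally have "(\<Sum>j<d. (cmod (?D i j))\<^sup>2) = 0"
      by (simp only: of_real_eq_0_iff)
    then show ?thesis
      using j by (simp add: sum_nonneg_eq_0_iff)
  qed
  show ?thesis
    using A B by (intro eq_matI) (auto simp: eq)
qed

text \<open>Diagonal operators embed classical probability: \<open>f\<close> serves as a
  distribution for states and as a response function for effects.\<close>

definition diag_op :: "nat \<Rightarrow> (nat \<Rightarrow> real) \<Rightarrow> complex mat" where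
  "diag_op d f = mat d d (\<lambda>(i, j). if i = j then complex_of_real (f i) else 0)"

lemma diag_op_carrier [simp]: "diag_op d f \<in> carrier_mat d d"
  by (simp add: diag_op_def)

lemma positive_diag_op:
  assumes "\<And>i. i < d \<Longrightarrow> 0 \<le> f i"
  shows "positive_op d (diag_op d f)"
  unfolding positive_op_def
proof (intro conjI ballI)
  fix v :: "complex vec"
  assume v: "v \<in> carrier_vec d"
  have entry: "(diag_op d f *\<^sub>v v) $ i = f i * v $ i" if "i < d" for i
    using v that by (simp add: diag_op_def scalar_prod_def if_distrib[of "\<lambda>x. x * _"] cong: if_cong)
  have "(diag_op d f *\<^sub>v v) \<bullet>c v = (\<Sum>i<d. complex_of_real (f i * (cmod (v $ i))\<^sup>2))"
    unfolding scalar_prod_def of_real_mult complex_norm_square using v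
    by (auto intro!: sum.cong simp: entry atLeast0LessThan simp del: index_mult_mat_vec)
  also have "\<dots> \<ge> 0"
    using assms by (intro sum_nonneg) (simp add: less_eq_complex_def)
  finally show "0 \<le> (diag_op d f *\<^sub>v v) \<bullet>c v" .
qed simp

lemma mat_trace_diag_op [simp]: "mat_trace (diag_op d f) = complex_of_real (\<Sum>i<d. f i)"
  by (simp add: mat_trace_def diag_op_def)

lemma diag_op_mult: "diag_op d f * diag_op d g = diag_op d (\<lambda>i. f i * g i)"
  by (intro eq_matI)
     (auto simp: diag_op_def scalar_prod_def if_distrib[of "\<lambda>x. x * _"] cong: if_cong)

text \<open>One binary measurement is enough to tell preparations 0 and 1 apart, and its effects are
  left unconstrained.\<close>

definition mid_scenario :: scenario where
  "mid_scenario = \<lparr>n_preps = 3, n_meas = 1, n_outs = 2,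
     prep_equivs = [[return_pmf 2, pmf_of_set {0, 1}]], meas_equivs = []\<rparr>"

lemma mid_scenario_simps [simp]:
  "n_preps mid_scenario = 3" "n_meas mid_scenario = 1" "n_outs mid_scenario = 2"
  "prep_equivs mid_scenario = [[return_pmf 2, pmf_of_set {0, 1}]]"
  "meas_equivs mid_scenario = []"
  by (simp_all add: mid_scenario_def)

lemma lessThan_two_three: "{..<2::nat} = {0, 1}" "{..<3::nat} = {0, 1, 2}"
  by auto

lemma contextuality_mid_scenario: "contextuality_scenario mid_scenario"
proof -
  \<comment> \<open>An equivalence must consist of distinct distributions; these two differ because
    their supports do.\<close>
  have "set_pmf (return_pmf (2::nat)) \<noteq> set_pmf (pmf_of_set {0, 1})"
    by simp
  then have "return_pmf (2::nat) \<noteq> pmf_of_set {0, 1}"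
    by metis
  then show ?thesis
    by (simp add: contextuality_scenario_def equiv_family_def)
qed

text \<open>Serves both ways: it extracts the midpoint equation from a pure realisation and verifies
  the equivalence for the classical bit.\<close>

lemma respects_mid_scenario_iff:
  fixes \<rho> :: "nat \<Rightarrow> complex mat"
  assumes carrier: "\<And>x. x < 3 \<Longrightarrow> \<rho> x \<in> carrier_mat d d"
  shows
  "respects_equivs d {..<3} [[return_pmf 2, pmf_of_set {0, 1}]] \<rho> \<longleftrightarrow>
     (\<forall>r<d. \<forall>c<d. (\<rho> 2 $$ (r, c)) = (\<rho> 0 $$ (r, c) + \<rho> 1 $$ (r, c)) / 2)"
proof -
  have dims [simp]: "dim_row (\<rho> x) = d" "dim_col (\<rho> x) = d" if "x \<in> {0, 1, 2}" for x
    using that carrier[of x] by auto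
  have left: "mixture d {..<3} (return_pmf 2) \<rho> = mat d d (\<lambda>(r, c). \<rho> 2 $$ (r, c))"
    unfolding mixture_def op_sum_def by (intro eq_matI) (auto simp: lessThan_two_three)
  have right: "mixture d {..<3} (pmf_of_set {0, 1}) \<rho> =
      mat d d (\<lambda>(r, c). (\<rho> 0 $$ (r, c) + \<rho> 1 $$ (r, c)) / 2)"
    unfolding mixture_def op_sum_def
    by (intro eq_matI) (auto simp: lessThan_two_three add_divide_distrib)
  \<comment> \<open>Of the four ordered pairs, two are trivial and the other two agree by
    symmetry.\<close>
  have "respects_equivs d {..<3} [[return_pmf 2, pmf_of_set {0, 1}]] \<rho> \<longleftrightarrow>
      mixture d {..<3} (return_pmf 2) \<rho> = mixture d {..<3} (pmf_of_set {0, 1}) \<rho>"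
    unfolding respects_equivs_def by (simp del: One_nat_def) metis
  then show ?thesis
    unfolding left right by (simp add: mat_eq_iff)
qed

lemma pure_mid_scenario_indistinguishable:
  assumes "p \<in> pure_quantum_behaviours mid_scenario"
  shows "p (0, 0, 0) = p (0, 1, 0)"
proof -
  obtain d \<rho> M where real: "quantum_realisation mid_scenario d \<rho> M p"
    and pure: "\<And>x. x < 3 \<Longrightarrow> pure_state (\<rho> x)"
    using assms by (auto simp: pure_quantum_behaviours_def)
  from real have pos: "\<And>x. x < 3 \<Longrightarrow> positive_op d (\<rho> x)"
    by (simp add: quantum_realisation_def density_op_def)
  then have carrier: "\<And>x. x < 3 \<Longrightarrow> \<rho> x \<in> carrier_mat d d"
    by (simp add: positive_op_def)
  have "respects_equivs d {..<3} [[return_pmf 2, pmf_of_set {0, 1}]] \<rho>"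
    using real by (simp add: quantum_realisation_def)
  then have "\<rho> 2 $$ (r, c) = (\<rho> 0 $$ (r, c) + \<rho> 1 $$ (r, c)) / 2" if "r < d" "c < d" for r c
    using that respects_mid_scenario_iff[of \<rho> d] carrier by blast
  then have "\<rho> 0 = \<rho> 1"
    by (intro pure_midpoint_unique[of d _ _ "\<rho> 2"] pos carrier pure) simp_all
  moreover have "complex_of_real (p (0, x, 0)) = mat_trace (\<rho> x * M 0 0)" if "x < 3" for x
    using real that by (simp add: quantum_realisation_def)
  from this[of 0] this[of 1] have "complex_of_real (p (0, 0, 0)) = mat_trace (\<rho> 0 * M 0 0)"
    "complex_of_real (p (0, 1, 0)) = mat_trace (\<rho> 1 * M 0 0)"
    by simp_all
  ultimately show ?thesis
    by (metis of_real_eq_iff)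
qed

text \<open>The distribution of a classical bit: preparations 0 and 1 fix its value, and preparation
  2 is a fair coin.\<close>

definition bit_state :: "nat \<Rightarrow> nat \<Rightarrow> real" where
  "bit_state x i = (if x = 2 then 1 / 2 else of_bool (i = x))"

definition bit_behaviour :: "nat \<times> nat \<times> nat \<Rightarrow> real" where
  "bit_behaviour = restrict (\<lambda>(k, x, y). bit_state x k) ({..<2} \<times> {..<3} \<times> {..<1})"

text \<open>Measuring in the basis in which all states are diagonal reads out the bit. State 2 is
  maximally mixed, hence not pure.\<close>

lemma bit_behaviour_quantum: "bit_behaviour \<in> quantum_behaviours mid_scenario"
proof -
  let ?\<rho> = "\<lambda>x. diag_op 2 (bit_state x)"
  let ?M = "\<lambda>y k. diag_op 2 (\<lambda>i. of_bool (i = k))"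
  have "density_op 2 (?\<rho> x)" if "x < 3" for x
    using that by (auto simp: density_op_def bit_state_def lessThan_two_three intro!: positive_diag_op)
  moreover have "povm 2 2 (?M y)" for y
    by (auto simp: povm_def op_sum_def diag_op_def lessThan_two_three mat_eq_iff
        intro!: positive_diag_op[unfolded diag_op_def])
  moreover have "complex_of_real (bit_behaviour (k, x, y)) = mat_trace (?\<rho> x * ?M y k)"
    if "k < 2" "x < 3" "y < 1" for k x y
    using that by (auto simp: bit_behaviour_def diag_op_mult lessThan_two_three)
  moreover have "respects_equivs 2 {..<3} [[return_pmf 2, pmf_of_set {0, 1}]] ?\<rho>"
    by (subst respects_mid_scenario_iff) (auto simp: diag_op_def bit_state_def less_2_cases_iff)
  moreover have "respects_equivs 2 ({..<2} \<times> {..<1}) [] (\<lambda>(k, y). ?M y k)"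
    by (simp add: respects_equivs_def)
  ultimately have "quantum_realisation mid_scenario 2 ?\<rho> ?M bit_behaviour"
    by (simp add: quantum_realisation_def del: One_nat_def)
  moreover have "bit_behaviour \<in> behaviours mid_scenario"
    by (simp add: behaviours_def bit_behaviour_def)
  ultimately show ?thesis
    unfolding quantum_behaviours_def by blast
qed

theorem mainTheorem6:
  shows "\<exists>T. contextuality_scenario T \<and> prep_equivs T \<noteq> [] \<and>
             pure_quantum_behaviours T \<subset> quantum_behaviours T"
proof (intro exI conjI psubsetI)
  show "contextuality_scenario mid_scenario"
    by (rule contextuality_mid_scenario)
  show "prep_equivs mid_scenario \<noteq> []"
    by simp
  show "pure_quantum_behaviours mid_scenario \<subseteq> quantum_behaviours mid_scenario"
    by (auto simp: pure_quantum_behaviours_def quantum_behaviours_def)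
  \<comment> \<open>Outcome 0 has probability 1 for preparation 0 and probability 0 for preparation
    1.\<close>
  have "bit_behaviour (0, 0, 0) \<noteq> bit_behaviour (0, 1, 0)"
    by (simp add: bit_behaviour_def bit_state_def)
  then show "pure_quantum_behaviours mid_scenario \<noteq> quantum_behaviours mid_scenario"
    using bit_behaviour_quantum pure_mid_scenario_indistinguishable by metis
qed

end
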